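(* Let $\alpha,\beta>0$ and let $F:\mathrm{BV}(\Omega)\to\mathbb{R}$ be $$F(u)=\min_{w\in L^2(\Omega)}\alpha\|Du-w\|_{\mathcal M}+\frac{\beta}{2}\|w\|_{L^2(\Omega)}^2 .$$ Then for every $u\in\mathrm{BV}(\Omega)$ $$F(u)=\int_\Omega\varphi(\nabla u)\,dx+\alpha|D^su|(\Omega),$$ where $\varphi:\mathbb{R}^d\to\mathbb{R}$ is given by $$\varphi(x)=\begin{cases}\alpha|x|-\frac{\alpha^2}{2\beta},& |x|\ge\frac{\alpha}{\beta},\\[2pt] \frac{\beta}{2}|x|^2,&|x|\le\frac{\alpha}{\beta}.\end{cases}$$
   Context: $\Omega\subset\mathbb{R}^d$ is an open, bounded set with Lipschitz boundary. $w\in L^2(\Omega)$ is $\mathbb{R}^d$-valued and identified with the measure $w\,\mathcal L^d$; $\|\mu\|_{\mathcal M}=|\mu|(\Omega)$ is the Radon (total variation) norm of a finite Radon measure. For $u\in\mathrm{BV}(\Omega)$ the distributional derivative is decomposed as $Du=\nabla u\,\mathcal L^d+D^su$ into its absolutely continuous part (with density $\nabla u$) and its singular part $D^su$ with respect to Lebesgue measure $\mathcal L^d$. $|x|$ is the Euclidean norm. *)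

theory Defs
  imports "HOL-Analysis.Analysis"
begin

text \<open>
  Near each boundary point, \<open>\<Omega>\<close> is the strict epigraph, in some direction \<open>e\<close>, of a Lipschitz
  function \<open>\<gamma>\<close> on the hyperplane orthogonal to \<open>e\<close>. The point \<open>x - (x \<bullet> e) *\<^sub>R e\<close> is the orthogonal
  projection of \<open>x\<close> to that hyperplane, so no choice of an orthonormal basis is needed.
\<close>

definition lipschitz_boundary :: "'a::euclidean_space set \<Rightarrow> bool" where
  "lipschitz_boundary \<Omega> \<longleftrightarrow>
     (\<forall>p \<in> frontier \<Omega>. \<exists>e \<gamma> L r. norm e = 1 \<and> r > 0 \<and> L-lipschitz_on {y. y \<bullet> e = 0} \<gamma> \<and>
        \<Omega> \<inter> ball p r = {x \<in> ball p r. x \<bullet> e > (\<gamma> (x - (x \<bullet> e) *\<^sub>R e) :: real)})"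

text \<open>
  Vector measures on \<open>\<Omega>\<close> are set functions; only their values on Borel subsets of \<open>\<Omega>\<close> matter.
\<close>

abbreviation borel_subsets :: "'a::topological_space set \<Rightarrow> 'a set set" where
  "borel_subsets \<Omega> \<equiv> sets (restrict_space borel \<Omega>)"

definition variation ::
    "'a::euclidean_space set \<Rightarrow> ('a set \<Rightarrow> 'b::real_normed_vector) \<Rightarrow> 'a set \<Rightarrow> ennreal" where
  "variation \<Omega> \<mu> A =
     (SUP E \<in> {E :: nat \<Rightarrow> 'a set.
        range E \<subseteq> borel_subsets \<Omega> \<and> disjoint_family E \<and> (\<Union>i. E i) = A}.
        \<Sum>i. ennreal (norm (\<mu> (E i))))"

text \<open>
  A finite Borel measure on an open subset of a Euclidean space is regular, so inner and outer
  regularity are not required separately.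
\<close>

definition finite_radon_measure ::
    "'a::euclidean_space set \<Rightarrow> ('a set \<Rightarrow> 'b::real_normed_vector) \<Rightarrow> bool" where
  "finite_radon_measure \<Omega> \<mu> \<longleftrightarrow>
     (\<forall>E :: nat \<Rightarrow> 'a set. range E \<subseteq> borel_subsets \<Omega> \<longrightarrow> disjoint_family E \<longrightarrow>
        (\<lambda>i. \<mu> (E i)) sums \<mu> (\<Union>i. E i)) \<and>
     variation \<Omega> \<mu> \<Omega> < \<infinity>"

text \<open>Since \<open>enn2real \<infinity> = 0\<close>, this is meaningful only for finite measures.\<close>

definition radon_norm ::
    "'a::euclidean_space set \<Rightarrow> ('a set \<Rightarrow> 'b::real_normed_vector) \<Rightarrow> real" where
  "radon_norm \<Omega> \<mu> = enn2real (variation \<Omega> \<mu> \<Omega>)"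

text \<open>The measure \<open>w \<L>\<close> with density \<open>w\<close> with respect to Lebesgue measure \<open>\<L>\<close>.\<close>

definition lebesgue_density ::
    "('a::euclidean_space \<Rightarrow> 'b::euclidean_space) \<Rightarrow> 'a set \<Rightarrow> 'b" where
  "lebesgue_density w A = set_lebesgue_integral lebesgue A w"

text \<open>
  The positive part \<open>\<nu>\<^sup>+(A) = sup {\<nu>(B). B \<subseteq> A}\<close> of the Jordan decomposition of a finite signed
  measure; \<open>ennreal\<close> truncates negative values to \<open>0 = \<nu>({})\<close>.
\<close>

definition jordan_pos :: "'a::euclidean_space set \<Rightarrow> ('a set \<Rightarrow> real) \<Rightarrow> 'a measure" where
  "jordan_pos \<Omega> \<nu> = measure_of \<Omega> (borel_subsets \<Omega>)
     (\<lambda>A. SUP B \<in> {B \<in> borel_subsets \<Omega>. B \<subseteq> A}. ennreal (\<nu> B))"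

definition signed_integral ::
    "'a::euclidean_space set \<Rightarrow> ('a set \<Rightarrow> real) \<Rightarrow> ('a \<Rightarrow> real) \<Rightarrow> real" where
  "signed_integral \<Omega> \<nu> f =
     integral\<^sup>L (jordan_pos \<Omega> \<nu>) f - integral\<^sup>L (jordan_pos \<Omega> (\<lambda>A. - \<nu> A)) f"

fun Ck :: "nat \<Rightarrow> ('a::euclidean_space \<Rightarrow> real) \<Rightarrow> bool" where
  "Ck 0 f \<longleftrightarrow> continuous_on UNIV f"
| "Ck (Suc k) f \<longleftrightarrow>
     (\<forall>x. f differentiable (at x)) \<and> (\<forall>i \<in> Basis. Ck k (\<lambda>x. frechet_derivative f (at x) i))"

definition test_function :: "'a::euclidean_space set \<Rightarrow> ('a \<Rightarrow> real) \<Rightarrow> bool" where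
  "test_function \<Omega> \<psi> \<longleftrightarrow>
     (\<forall>k. Ck k \<psi>) \<and> (\<exists>K. compact K \<and> K \<subseteq> \<Omega> \<and> (\<forall>x. x \<notin> K \<longrightarrow> \<psi> x = 0))"

definition distributional_derivative ::
    "'a::euclidean_space set \<Rightarrow> ('a \<Rightarrow> real) \<Rightarrow> ('a set \<Rightarrow> 'a) \<Rightarrow> bool" where
  "distributional_derivative \<Omega> u \<mu> \<longleftrightarrow>
     finite_radon_measure \<Omega> \<mu> \<and>
     (\<forall>\<psi>. test_function \<Omega> \<psi> \<longrightarrow> (\<forall>i \<in> Basis.
        (LINT x|lebesgue_on \<Omega>. u x * frechet_derivative \<psi> (at x) i) =
        - signed_integral \<Omega> (\<lambda>A. \<mu> A \<bullet> i) \<psi>))"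

definition BV :: "'a::euclidean_space set \<Rightarrow> ('a \<Rightarrow> real) set" where
  "BV \<Omega> = {u. integrable (lebesgue_on \<Omega>) u \<and> (\<exists>\<mu>. distributional_derivative \<Omega> u \<mu>)}"

text \<open>
  For open \<open>\<Omega>\<close> the derivative of a BV function is unique on the Borel subsets of \<open>\<Omega>\<close>, so the choice
  is immaterial.
\<close>

definition D :: "'a::euclidean_space set \<Rightarrow> ('a \<Rightarrow> real) \<Rightarrow> 'a set \<Rightarrow> 'a" where
  "D \<Omega> u = (SOME \<mu>. distributional_derivative \<Omega> u \<mu>)"

definition singular_measure ::
    "'a::euclidean_space set \<Rightarrow> ('a set \<Rightarrow> 'b::real_normed_vector) \<Rightarrow> bool" where
  "singular_measure \<Omega> \<nu> \<longleftrightarrow>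
     (\<exists>N \<in> borel_subsets \<Omega>. N \<in> null_sets lebesgue \<and> variation \<Omega> \<nu> (\<Omega> - N) = 0)"

definition lebesgue_decomposition ::
    "'a::euclidean_space set \<Rightarrow> ('a set \<Rightarrow> 'b::euclidean_space) \<Rightarrow> ('a \<Rightarrow> 'b) \<Rightarrow> ('a set \<Rightarrow> 'b) \<Rightarrow> bool"
  where
  "lebesgue_decomposition \<Omega> \<mu> g \<nu> \<longleftrightarrow>
     integrable (lebesgue_on \<Omega>) g \<and> finite_radon_measure \<Omega> \<nu> \<and> singular_measure \<Omega> \<nu> \<and>
     (\<forall>A \<in> borel_subsets \<Omega>. \<mu> A = lebesgue_density g A + \<nu> A)"

text \<open>The density \<open>\<nabla>u\<close> is unique up to Lebesgue null sets.\<close>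

definition grad :: "'a::euclidean_space set \<Rightarrow> ('a \<Rightarrow> real) \<Rightarrow> 'a \<Rightarrow> 'a" where
  "grad \<Omega> u = (SOME g. \<exists>\<nu>. lebesgue_decomposition \<Omega> (D \<Omega> u) g \<nu>)"

definition D_sing :: "'a::euclidean_space set \<Rightarrow> ('a \<Rightarrow> real) \<Rightarrow> 'a set \<Rightarrow> 'a" where
  "D_sing \<Omega> u A = D \<Omega> u A - lebesgue_density (grad \<Omega> u) A"

definition L2 :: "'a::euclidean_space set \<Rightarrow> ('a \<Rightarrow> 'b::euclidean_space) set" where
  "L2 \<Omega> = {w \<in> borel_measurable (lebesgue_on \<Omega>). integrable (lebesgue_on \<Omega>) (\<lambda>x. (norm (w x))\<^sup>2)}"

definition L2_norm :: "'a::euclidean_space set \<Rightarrow> ('a \<Rightarrow> 'b::euclidean_space) \<Rightarrow> real" where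
  "L2_norm \<Omega> w = sqrt (LINT x|lebesgue_on \<Omega>. (norm (w x))\<^sup>2)"

definition objective ::
    "real \<Rightarrow> real \<Rightarrow> 'a::euclidean_space set \<Rightarrow> ('a \<Rightarrow> real) \<Rightarrow> ('a \<Rightarrow> 'a) \<Rightarrow> real" where
  "objective \<alpha> \<beta> \<Omega> u w =
     \<alpha> * radon_norm \<Omega> (\<lambda>A. D \<Omega> u A - lebesgue_density w A) + \<beta> / 2 * (L2_norm \<Omega> w)\<^sup>2"

definition functional_F ::
    "real \<Rightarrow> real \<Rightarrow> 'a::euclidean_space set \<Rightarrow> ('a \<Rightarrow> real) \<Rightarrow> real" where
  "functional_F \<alpha> \<beta> \<Omega> u = (LEAST t. t \<in> objective \<alpha> \<beta> \<Omega> u ` L2 \<Omega>)"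

definition phi :: "real \<Rightarrow> real \<Rightarrow> 'a::euclidean_space \<Rightarrow> real" where
  "phi \<alpha> \<beta> x =
     (if norm x \<ge> \<alpha> / \<beta> then \<alpha> * norm x - \<alpha>\<^sup>2 / (2 * \<beta>) else \<beta> / 2 * (norm x)\<^sup>2)"

end

(* With g = grad u, the measure Du - w has density g - w and singular part D^s u, so the objective is
   \<integral> \<alpha> |g - w| + \<beta>/2 |w|\<^sup>2 dx + \<alpha> |D^s u|(\<Omega>). The integrand is minimised pointwise in w by the
   projection of g to the ball of radius \<alpha>/\<beta>, which is bounded and hence in L^2, and the minimal value
   of the integrand is \<phi>(g). *)

theory Submission
  imports Defs
begin

text \<open>\<open>D\<close> and \<open>grad\<close> are Hilbert choices, so \<open>grad\<close>
  becomes usable only once a Lebesgue decomposition of a vector measure is known to exist; its total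
  variation serves as the positive measure that dominates all components. The norm is a supremum
  over countable Borel partitions. For a vector-valued density it equals the integral of the
  Euclidean norm because partitions exist on whose pieces the density is nearly constant. Densities
  are only Lebesgue measurable, so such pieces have to be trimmed to Borel sets. The norms of the
  absolutely continuous and the singular part add up because the two parts live on disjoint sets.
  Since \<Omega> is bounded, it has finite measure, so that square integrable fields are integrable
  and bounded measurable ones are square integrable. The threshold \<alpha>/\<beta> is the radius at
  which the slope \<beta>|v| of the quadratic term reaches the slope \<alpha> of the norm term; the
  constant \<alpha>^2/(2\<beta>) makes both branches of \<open>phi\<close> agree there.\<close>

section \<open>Total variation as a set function: superadditivity and countable additivity\<close>

text \<open>Used to discard a summand of a measure on a set where that summand vanishes, and to
  exchange set functions that agree only on Borel sets.\<close>

lemma variation_cong: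
  assumes "\<And>B. B \<in> borel_subsets \<Omega> \<Longrightarrow> B \<subseteq> A \<Longrightarrow> \<mu> B = \<nu> B"
  shows "variation \<Omega> \<mu> A = variation \<Omega> \<nu> A"
proof -
  have "\<mu> (E i) = \<nu> (E i)"
    if "range E \<subseteq> borel_subsets \<Omega>" "(\<Union>i. E i) = A" for E :: "nat \<Rightarrow> 'a set" and i
    using that by (intro assms) auto
  then show ?thesis
    unfolding variation_def by (intro SUP_cong) auto
qed

lemma suminf_norm_le_variation:
  assumes "range E \<subseteq> borel_subsets \<Omega>" "disjoint_family E" "(\<Union>i. E i) = A"
  shows "(\<Sum>i. ennreal (norm (\<mu> (E i)))) \<le> variation \<Omega> \<mu> A"
  unfolding variation_def using assms by (intro SUP_upper2[where i = E]) auto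

lemma variation_leI:
  assumes "\<And>E :: nat \<Rightarrow> 'a::euclidean_space set. range E \<subseteq> borel_subsets \<Omega> \<Longrightarrow> disjoint_family E \<Longrightarrow>
             (\<Union>i. E i) = A \<Longrightarrow> (\<Sum>i. ennreal (norm (\<mu> (E i)))) \<le> c"
  shows "variation \<Omega> \<mu> A \<le> c"
  unfolding variation_def using assms by (intro SUP_least) auto

lemma trivial_partition:
  assumes "A \<in> sets M"
  shows "range (\<lambda>i::nat. if i = 0 then A else {}) \<subseteq> sets M"
    "disjoint_family (\<lambda>i::nat. if i = 0 then A else {})"
    "(\<Union>i::nat. if i = 0 then A else {}) = A"
  using assms by (auto simp: disjoint_family_on_def split: if_splits)

lemma norm_le_variation:
  assumes "A \<in> borel_subsets \<Omega>"
  shows "ennreal (norm (\<mu> A)) \<le> variation \<Omega> \<mu> A"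
proof -
  let ?E = "\<lambda>i::nat. if i = 0 then A else {}"
  \<comment> \<open>Only the term of index 0 is kept, because \<open>\<mu> {}\<close> may be nonzero
    for an arbitrary set function.\<close>
  have "ennreal (norm (\<mu> A)) = (\<Sum>i\<in>{0::nat}. ennreal (norm (\<mu> (?E i))))"
    by simp
  also have "\<dots> \<le> (\<Sum>i. ennreal (norm (\<mu> (?E i))))"
    by (rule sum_le_suminf) auto
  also have "\<dots> \<le> variation \<Omega> \<mu> A"
    by (rule suminf_norm_le_variation) (rule trivial_partition[OF assms])+
  finally show ?thesis .
qed

text \<open>Partitions of \<open>A\<close> and of \<open>B\<close> are interleaved to one of \<open>A \<union> B\<close>.\<close>

lemma variation_superadditive:
  assumes A: "A \<in> borel_subsets \<Omega>" and B: "B \<in> borel_subsets \<Omega>" and "A \<inter> B = {}"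
  shows "variation \<Omega> \<mu> A + variation \<Omega> \<mu> B \<le> variation \<Omega> \<mu> (A \<union> B)"
proof -
  let ?P = "\<lambda>A. {E :: nat \<Rightarrow> 'a set. range E \<subseteq> borel_subsets \<Omega> \<and> disjoint_family E \<and> (\<Union>i. E i) = A}"
  let ?s = "\<lambda>E :: nat \<Rightarrow> 'a set. \<Sum>i. ennreal (norm (\<mu> (E i)))"
  \<comment> \<open>A supremum commutes with adding a constant in \<open>ennreal\<close> only over a
    nonempty index set.\<close>
  have ne: "?P A \<noteq> {}" "?P B \<noteq> {}"
    using trivial_partition[OF A] trivial_partition[OF B] by blast+
  have *: "?s E + ?s F \<le> variation \<Omega> \<mu> (A \<union> B)" if E: "E \<in> ?P A" and F: "F \<in> ?P B" for E F
  proof -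
    define G where "G n = (if even n then E (n div 2) else F (n div 2))" for n
    have G: "G (2 * n) = E n" "G (Suc (2 * n)) = F n" for n
      by (auto simp: G_def)
    \<comment> \<open>The first \<open>n\<close> pairs are the first \<open>2 * n\<close> terms of
      the interleaved sequence, so comparing partial sums replaces a rearrangement of the
      series.\<close>
    have sum: "(\<Sum>i<n. ennreal (norm (\<mu> (E i))) + ennreal (norm (\<mu> (F i)))) =
               (\<Sum>i<2 * n. ennreal (norm (\<mu> (G i))))" for n
    proof (induction n)
      case (Suc n)
      have "{..<2 * Suc n} = insert (Suc (2 * n)) (insert (2 * n) {..<2 * n})"
        by auto
      then show ?case
        using Suc by (simp add: G G[unfolded mult.commute[of 2]] ac_simps del: sum_ennreal)
    qed auto
    have "?s E + ?s F = (\<Sum>i. ennreal (norm (\<mu> (E i))) + ennreal (norm (\<mu> (F i))))"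
      by (rule suminf_add) auto
    also have "\<dots> \<le> ?s G"
    proof (rule suminf_le_const)
      show "(\<Sum>i<n. ennreal (norm (\<mu> (E i))) + ennreal (norm (\<mu> (F i)))) \<le> ?s G" for n
        unfolding sum by (rule sum_le_suminf) auto
    qed auto
    also have "\<dots> \<le> variation \<Omega> \<mu> (A \<union> B)"
    proof (rule suminf_norm_le_variation)
      show "range G \<subseteq> borel_subsets \<Omega>"
        using E F by (auto simp: G_def)
      have sub: "E i \<inter> F j = {}" "F j \<inter> E i = {}" for i j
        using E F \<open>A \<inter> B = {}\<close> by blast+
      have dis: "i \<noteq> j \<Longrightarrow> E i \<inter> E j = {}" "i \<noteq> j \<Longrightarrow> F i \<inter> F j = {}" for i j
        using E F by (auto simp: disjoint_family_on_def)
      show "disjoint_family G"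
        unfolding disjoint_family_on_def
      proof (intro ballI impI)
        fix m n :: nat assume "m \<noteq> n"
        then have "m div 2 \<noteq> n div 2" if "even m = even n"
          using that by (metis dvd_mult_div_cancel odd_two_times_div_two_succ)
        then show "G m \<inter> G n = {}"
          by (cases "even m"; cases "even n") (simp_all add: G_def sub dis)
      qed
      have "E i \<subseteq> (\<Union>i. G i)" "F i \<subseteq> (\<Union>i. G i)" for i
        using UN_upper[of "2 * i" UNIV G] UN_upper[of "Suc (2 * i)" UNIV G]
        unfolding G by simp_all
      moreover have "G i \<subseteq> A \<union> B" for i
        using E F UN_upper[of "i div 2" UNIV E] UN_upper[of "i div 2" UNIV F]
        by (simp add: G_def le_supI1 le_supI2)
      ultimately show "(\<Union>i. G i) = A \<union> B"
        using E F by (simp add: set_eq_iff subset_eq) blast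
    qed
    finally show ?thesis .
  qed
  have "variation \<Omega> \<mu> A + variation \<Omega> \<mu> B = (SUP F\<in>?P B. SUP E\<in>?P A. ?s E + ?s F)"
    unfolding variation_def
    by (simp only: ennreal_SUP_add_left[OF ne(1), symmetric] ennreal_SUP_add_right[OF ne(2)])
  also have "\<dots> \<le> variation \<Omega> \<mu> (A \<union> B)"
    by (intro SUP_least *)
  finally show ?thesis .
qed

lemma variation_mono:
  assumes "A \<in> borel_subsets \<Omega>" "B \<in> borel_subsets \<Omega>" "A \<subseteq> B"
  shows "variation \<Omega> \<mu> A \<le> variation \<Omega> \<mu> B"
proof -
  have "variation \<Omega> \<mu> A \<le> variation \<Omega> \<mu> A + variation \<Omega> \<mu> (B - A)"
    by simp
  also have "\<dots> \<le> variation \<Omega> \<mu> (A \<union> (B - A))"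
    using assms by (intro variation_superadditive) auto
  finally show ?thesis
    using assms by (simp add: Un_absorb1)
qed

text \<open>Tonelli for double series: one of the two sums is an integral over counting measure,
  which commutes with countable sums of nonnegative functions.\<close>

lemma suminf_swap_ennreal:
  fixes f :: "nat \<Rightarrow> nat \<Rightarrow> ennreal"
  shows "(\<Sum>i. \<Sum>j. f i j) = (\<Sum>j. \<Sum>i. f i j)"
  using nn_integral_suminf[of "\<lambda>j i. f i j" "count_space UNIV"]
  by (simp add: nn_integral_count_space_nat)

lemma finite_radon_measure_sums:
  fixes \<mu> :: "'a::euclidean_space set \<Rightarrow> 'b::real_normed_vector"
  assumes "finite_radon_measure \<Omega> \<mu>" "\<And>i::nat. E i \<in> borel_subsets \<Omega>" "disjoint_family E"
  shows "(\<lambda>i. \<mu> (E i)) sums \<mu> (\<Union>i. E i)"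
  using assms by (simp add: finite_radon_measure_def image_subset_iff)

text \<open>One inequality is finite superadditivity with monotonicity, passed to the limit. For the
  other, each piece of a partition of the union is cut along the sets \<open>A n\<close>; countable
  additivity of \<open>\<mu>\<close> and the triangle inequality bound its norm, and the order of
  summation is exchanged.\<close>

lemma variation_additive:
  assumes fin: "finite_radon_measure \<Omega> \<mu>"
    and A: "range A \<subseteq> borel_subsets \<Omega>" "disjoint_family A"
  shows "(\<Sum>n::nat. variation \<Omega> \<mu> (A n)) = variation \<Omega> \<mu> (\<Union>n. A n)"
proof (rule antisym)
  have UA: "(\<Union>n. A n) \<in> borel_subsets \<Omega>"
    using A(1) by blast
  have An: "A n \<in> borel_subsets \<Omega>" for n
    using A(1) by blast
  have Ak: "(\<Union>n<k. A n) \<in> borel_subsets \<Omega>" for k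
    by (rule sets.finite_UN) (use An in auto)
  have le: "(\<Sum>n<k. variation \<Omega> \<mu> (A n)) \<le> variation \<Omega> \<mu> (\<Union>n<k. A n)" for k
  proof (induction k)
    case (Suc k)
    have "(\<Sum>n<Suc k. variation \<Omega> \<mu> (A n)) \<le> variation \<Omega> \<mu> (\<Union>n<k. A n) + variation \<Omega> \<mu> (A k)"
      using Suc by (simp add: add_right_mono)
    also have "\<dots> \<le> variation \<Omega> \<mu> ((\<Union>n<k. A n) \<union> A k)"
    proof (rule variation_superadditive[OF Ak An])
      have "A n \<inter> A k = {}" if "n < k" for n
        using disjoint_family_onD[OF A(2), of n k] that by simp
      then show "(\<Union>n<k. A n) \<inter> A k = {}"
        by blast
    qed
    finally show ?case
      by (simp add: lessThan_Suc Un_commute)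
  qed auto
  have "variation \<Omega> \<mu> (\<Union>n<k. A n) \<le> variation \<Omega> \<mu> (\<Union>n. A n)" for k
    by (intro variation_mono UA Ak) auto
  then show "(\<Sum>n. variation \<Omega> \<mu> (A n)) \<le> variation \<Omega> \<mu> (\<Union>n. A n)"
    using le by (intro suminf_le_const) (auto intro: order_trans)
next
  show "variation \<Omega> \<mu> (\<Union>n. A n) \<le> (\<Sum>n. variation \<Omega> \<mu> (A n))"
  proof (rule variation_leI)
    fix E :: "nat \<Rightarrow> 'a set"
    assume E: "range E \<subseteq> borel_subsets \<Omega>" "disjoint_family E" "(\<Union>i. E i) = (\<Union>n. A n)"
    have EA: "E i \<inter> A n \<in> borel_subsets \<Omega>" for i n
      using E(1) A(1) by blast
    \<comment> \<open>An infinite right-hand side bounds anything; a finite one is a convergent real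
      series that bounds the norms of all partial sums, hence of their limit
      \<open>\<mu> (E i)\<close>.\<close>
    have "ennreal (norm (\<mu> (E i))) \<le> (\<Sum>n. ennreal (norm (\<mu> (E i \<inter> A n))))" for i
    proof (cases "(\<Sum>n. ennreal (norm (\<mu> (E i \<inter> A n)))) = top")
      case False
      then have sm: "summable (\<lambda>n. norm (\<mu> (E i \<inter> A n)))"
        by (intro summable_suminf_not_top) auto
      have "(\<lambda>n. \<mu> (E i \<inter> A n)) sums \<mu> (\<Union>n. E i \<inter> A n)"
      proof (rule finite_radon_measure_sums[OF fin EA])
        show "disjoint_family (\<lambda>n. E i \<inter> A n)"
          using disjoint_family_onD[OF A(2)] by (fastforce simp: disjoint_family_on_def)
      qed
      moreover have "E i \<subseteq> (\<Union>n. A n)"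
        unfolding E(3)[symmetric] by (rule UN_upper) simp
      then have "(\<Union>n. E i \<inter> A n) = E i"
        by blast
      ultimately have sums: "(\<lambda>n. \<mu> (E i \<inter> A n)) sums \<mu> (E i)"
        by simp
      have "norm (\<mu> (E i)) \<le> (\<Sum>n. norm (\<mu> (E i \<inter> A n)))"
      proof (rule Lim_norm_ubound[of sequentially "\<lambda>k. \<Sum>n<k. \<mu> (E i \<inter> A n)"])
        show "eventually (\<lambda>k. norm (\<Sum>n<k. \<mu> (E i \<inter> A n)) \<le> (\<Sum>n. norm (\<mu> (E i \<inter> A n)))) sequentially"
          by (intro always_eventually allI order_trans[OF norm_sum] sum_le_suminf sm) auto
      qed (use sums in \<open>auto simp: sums_def\<close>)
      then show ?thesis
        using False by (simp add: ennreal_leI)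
    qed auto
    then have "(\<Sum>i. ennreal (norm (\<mu> (E i)))) \<le> (\<Sum>i. \<Sum>n. ennreal (norm (\<mu> (E i \<inter> A n))))"
      by (intro suminf_le) auto
    also have "\<dots> = (\<Sum>n. \<Sum>i. ennreal (norm (\<mu> (E i \<inter> A n))))"
      by (rule suminf_swap_ennreal)
    also have "\<dots> \<le> (\<Sum>n. variation \<Omega> \<mu> (A n))"
    proof (intro suminf_le suminf_norm_le_variation)
      fix n
      show "disjoint_family (\<lambda>i. E i \<inter> A n)"
        using disjoint_family_onD[OF E(2)] by (fastforce simp: disjoint_family_on_def)
      have "A n \<subseteq> (\<Union>i. E i)"
        unfolding E(3) by (rule UN_upper) simp
      then show "(\<Union>i. E i \<inter> A n) = A n"
        by blast
    qed (use EA in auto)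
    finally show "(\<Sum>i. ennreal (norm (\<mu> (E i)))) \<le> (\<Sum>n. variation \<Omega> \<mu> (A n))" .
  qed
qed

section \<open>The pointwise minimisation problem\<close>

text \<open>The reverse triangle inequality reduces the claim to the lengths \<open>r\<close> and
  \<open>s\<close>, where it is an inequality between quadratic polynomials.\<close>

lemma phi_le:
  assumes "\<alpha> > 0" "\<beta> > 0"
  shows "phi \<alpha> \<beta> x \<le> \<alpha> * norm (x - v) + \<beta> / 2 * (norm v)\<^sup>2"
proof -
  define r s where "r = norm x" and "s = norm v"
  have rs: "r \<ge> 0" "s \<ge> 0" "\<alpha> * (r - s) \<le> \<alpha> * norm (x - v)"
    using \<open>\<alpha> > 0\<close> by (auto simp: r_def s_def norm_triangle_ineq2)
  show ?thesis
  proof (cases "r \<ge> \<alpha> / \<beta>")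
    case True
    \<comment> \<open>Completes the square of \<open>\<beta> / 2 * s\<^sup>2 - \<alpha> * s\<close>,
      whose minimum lies at \<open>s = \<alpha> / \<beta>\<close>.\<close>
    have "0 \<le> (\<beta> * s - \<alpha>)\<^sup>2 / (2 * \<beta>)"
      using \<open>\<beta> > 0\<close> by simp
    also have "\<dots> = \<beta> / 2 * s\<^sup>2 - \<alpha> * s + \<alpha>\<^sup>2 / (2 * \<beta>)"
      using \<open>\<beta> > 0\<close> by (simp add: field_simps power2_eq_square)
    finally show ?thesis
      using True rs by (simp add: phi_def r_def s_def algebra_simps)
  next
    case False
    then have r: "\<beta> * r < \<alpha>"
      using \<open>\<beta> > 0\<close> by (simp add: field_simps)
    have "\<beta> / 2 * r\<^sup>2 \<le> \<alpha> * norm (x - v) + \<beta> / 2 * s\<^sup>2"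
    proof (cases "r \<le> s")
      case True
      then have "\<beta> / 2 * r\<^sup>2 \<le> \<beta> / 2 * s\<^sup>2"
        using \<open>\<beta> > 0\<close> rs by (simp add: power_mono)
      then show ?thesis
        using \<open>\<alpha> > 0\<close> by (simp add: add_increasing)
    next
      case False
      then have "\<beta> * s \<le> \<beta> * r"
        using \<open>\<beta> > 0\<close> by simp
      \<comment> \<open>The product is twice the difference of the two sides once
        \<open>norm (x - v)\<close> is replaced by \<open>r - s\<close>; the second factor is
        positive because both \<open>\<beta> * s\<close> and \<open>\<beta> * r\<close> lie below
        \<alpha>.\<close>
      then have "0 \<le> (r - s) * (2 * \<alpha> - (\<beta> * r + \<beta> * s))"
        using False r by (intro mult_nonneg_nonneg) linarith+
      then have "\<beta> / 2 * r\<^sup>2 \<le> \<alpha> * (r - s) + \<beta> / 2 * s\<^sup>2"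
        by (simp add: algebra_simps power2_eq_square)
      then show ?thesis
        using rs by linarith
    qed
    then show ?thesis
      using False by (simp add: phi_def r_def s_def)
  qed
qed

text \<open>The projection of \<open>x\<close> to the ball of radius \<open>\<alpha> / \<beta>\<close>.\<close>

definition huber_min :: "real \<Rightarrow> real \<Rightarrow> 'a::euclidean_space \<Rightarrow> 'a" where
  "huber_min \<alpha> \<beta> x = (if norm x \<ge> \<alpha> / \<beta> then (\<alpha> / \<beta> / norm x) *\<^sub>R x else x)"

lemma norm_huber_min_le:
  assumes "\<alpha> > 0" "\<beta> > 0"
  shows "norm (huber_min \<alpha> \<beta> x) \<le> \<alpha> / \<beta>"
  using assms by (auto simp: huber_min_def)

text \<open>Outside the ball, \<open>x\<close> and its projection lie on one ray, so their distance
  is \<open>norm x - \<alpha> / \<beta>\<close>; inside, the distance is zero and only the quadratic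
  term remains.\<close>

lemma phi_eq_huber_min:
  assumes "\<alpha> > 0" "\<beta> > 0"
  shows "phi \<alpha> \<beta> x = \<alpha> * norm (x - huber_min \<alpha> \<beta> x) + \<beta> / 2 * (norm (huber_min \<alpha> \<beta> x))\<^sup>2"
proof (cases "norm x \<ge> \<alpha> / \<beta>")
  case True
  then have x: "norm x > 0"
    using assms by (meson divide_pos_pos less_le_trans)
  have "x - huber_min \<alpha> \<beta> x = (1 - \<alpha> / \<beta> / norm x) *\<^sub>R x"
    using True by (simp add: huber_min_def algebra_simps)
  moreover have "1 - \<alpha> / \<beta> / norm x \<ge> 0"
    using True x assms by (simp add: pos_divide_le_eq mult.commute)
  ultimately have "norm (x - huber_min \<alpha> \<beta> x) = (1 - \<alpha> / \<beta> / norm x) * norm x"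
    by simp
  also have "\<dots> = norm x - \<alpha> / \<beta>"
    using x by (simp add: field_simps)
  finally have 1: "norm (x - huber_min \<alpha> \<beta> x) = norm x - \<alpha> / \<beta>" .
  have 2: "norm (huber_min \<alpha> \<beta> x) = \<alpha> / \<beta>"
    using True x assms by (simp add: huber_min_def)
  show ?thesis
    using True assms unfolding 1 2 by (simp add: phi_def field_simps power2_eq_square)
qed (simp add: phi_def huber_min_def)


lemma huber_min_measurable [measurable]: "huber_min \<alpha> \<beta> \<in> borel_measurable borel"
  unfolding huber_min_def[abs_def] by measurable

lemma phi_measurable [measurable]: "phi \<alpha> \<beta> \<in> borel_measurable borel"
  unfolding phi_def[abs_def] by measurable

section \<open>Real Radon-Nikodym densities and null sets of maximal mass\<close>

text \<open>Transfers the theorem for measures to a nonnegative real set function: \<open>f\<close>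
  becomes a measure through \<open>measure_of\<close>, and the \<open>ennreal\<close> density is
  turned back into a real one.\<close>

lemma real_Radon_Nikodym:
  assumes "finite_measure M"
    and nonneg: "\<And>A. A \<in> sets M \<Longrightarrow> 0 \<le> f A"
    and sums: "\<And>A. range A \<subseteq> sets M \<Longrightarrow> disjoint_family A \<Longrightarrow> (\<lambda>i::nat. f (A i)) sums (f (\<Union>i. A i) :: real)"
    and ac: "\<And>A. A \<in> null_sets M \<Longrightarrow> f A = 0"
  obtains g where "integrable M g" "\<And>A. A \<in> sets M \<Longrightarrow> f A = (LINT x:A|M. g x)"
proof -
  interpret finite_measure M by fact
  define N where "N = measure_of (space M) (sets M) (\<lambda>A. ennreal (f A))"
  have sets_N [simp]: "sets N = sets M"
    by (simp add: N_def)
  have empty: "f {} = 0"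
    using ac by simp
  have em: "emeasure N A = ennreal (f A)" if "A \<in> sets M" for A
  proof (rule emeasure_measure_of[OF N_def])
    show "countably_additive (sets N) (\<lambda>A. ennreal (f A))"
    proof (rule countably_additiveI)
      fix A :: "nat \<Rightarrow> 'a set"
      assume A: "range A \<subseteq> sets N" "disjoint_family A" "(\<Union>i. A i) \<in> sets N"
      then show "(\<Sum>i. ennreal (f (A i))) = ennreal (f (\<Union>i. A i))"
        using sums[of A] nonneg by (intro suminf_ennreal_eq) auto
    qed
  qed (use that in \<open>auto simp: sets.space_closed positive_def empty\<close>)
  have "absolutely_continuous M N"
    unfolding absolutely_continuous_def
    using ac by (auto simp: null_sets_def em)
  then obtain h where h: "h \<in> borel_measurable M" and dens: "density M h = N"
    using Radon_Nikodym[OF _ sets_N] by blast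
  have h_int: "(\<integral>\<^sup>+x\<in>A. h x \<partial>M) = ennreal (f A)" if "A \<in> sets M" for A
    using emeasure_density[OF h that] em[OF that] dens by simp
  note [measurable] = h
  \<comment> \<open>The total mass \<open>f (space M)\<close> is a real number, so \<open>h\<close>
    is finite almost everywhere and \<open>enn2real\<close> changes it only on a null set.\<close>
  have "(\<integral>\<^sup>+x. h x \<partial>M) \<noteq> \<infinity>"
    using h_int[of "space M"] by simp
  then have "AE x in M. h x \<noteq> \<infinity>"
    by (intro nn_integral_noteq_infinite) auto
  then have AE: "AE x in M. ennreal (enn2real (h x)) = h x"
    by eventually_elim (simp add: less_top)
  have eq: "(\<integral>\<^sup>+x\<in>A. ennreal (enn2real (h x)) \<partial>M) = ennreal (f A)" if "A \<in> sets M" for A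
    unfolding h_int[OF that, symmetric] using AE by (intro nn_integral_cong_AE) (auto elim!: eventually_mono)
  show ?thesis
  proof
    show int: "integrable M (\<lambda>x. enn2real (h x))"
      using eq[of "space M"] by (intro integrableI_bounded) auto
    fix A assume A [measurable]: "A \<in> sets M"
    have "set_integrable M A (\<lambda>x. enn2real (h x))"
      unfolding set_integrable_def by (rule integrable_mult_indicator[OF A int])
    from nn_integral_eq_integral[OF this[unfolded set_integrable_def]]
    have "ennreal (LINT x:A|M. enn2real (h x)) = (\<integral>\<^sup>+x. ennreal (indicator A x *\<^sub>R enn2real (h x)) \<partial>M)"
      by (simp add: set_lebesgue_integral_def)
    also have "\<dots> = (\<integral>\<^sup>+x\<in>A. ennreal (enn2real (h x)) \<partial>M)"
      by (intro nn_integral_cong) (auto split: split_indicator)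
    finally have "ennreal (LINT x:A|M. enn2real (h x)) = ennreal (f A)"
      using eq[OF A] by simp
    then show "f A = (LINT x:A|M. enn2real (h x))"
      using nonneg[OF A] by (subst (asm) ennreal_inj) (auto simp: set_lebesgue_integral_def)
  qed
qed

text \<open>\<open>N\<close> is a null set of maximal \<open>f\<close>-measure.\<close>

lemma exhausting_null_set:
  fixes f :: "'a set \<Rightarrow> real"
  assumes nonneg: "\<And>A. A \<in> sets M \<Longrightarrow> 0 \<le> f A"
    and add: "\<And>A B. A \<in> sets M \<Longrightarrow> B \<in> sets M \<Longrightarrow> A \<inter> B = {} \<Longrightarrow> f A + f B \<le> f (A \<union> B)"
  obtains N where "N \<in> null_sets M" "\<And>A. A \<in> null_sets M \<Longrightarrow> f (A - N) = 0"
proof -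
  have mono: "f A \<le> f B" if "A \<in> sets M" "B \<in> sets M" "A \<subseteq> B" for A B
    using add[of A "B - A"] nonneg[of "B - A"] that by (simp add: Un_absorb1)
  have bdd: "bdd_above (f ` null_sets M)"
    by (rule bdd_aboveI2[of _ _ "f (space M)"]) (auto intro!: mono dest: sets.sets_into_space)
  define s where "s = (SUP A\<in>null_sets M. f A)"
  have "\<exists>A\<in>null_sets M. s - inverse (Suc n) < f A" for n
    using less_cSUP_iff[OF _ bdd, of "s - inverse (Suc n)"] unfolding s_def by auto
  then obtain A where A: "A n \<in> null_sets M" "s - inverse (Suc n) < f (A n)" for n
    by metis
  \<comment> \<open>A countable union of null sets is null, and by monotonicity its value exceeds or
    equals \<open>s - inverse (Suc n)\<close> for every \<open>n\<close>, so the supremum is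
    attained.\<close>
  define N where "N = (\<Union>n. A n)"
  have N: "N \<in> null_sets M"
    unfolding N_def using A by auto
  have "s - inverse (Suc n) \<le> f N" for n
    using A(2)[of n] mono[of "A n" N] A(1)[of n] N by (fastforce simp: N_def)
  then have "s \<le> f N"
    using LIMSEQ_le_const2[of "\<lambda>n. s - inverse (real (Suc n))" s "f N"]
      tendsto_diff[OF tendsto_const LIMSEQ_inverse_real_of_nat, of s] by auto
  show ?thesis
  proof
    fix B assume B: "B \<in> null_sets M"
    \<comment> \<open>\<open>N \<union> (B - N)\<close> competes for the supremum that
      \<open>N\<close> already attains, which leaves no mass for \<open>B - N\<close>.\<close>
    have "f N + f (B - N) \<le> f (N \<union> (B - N))"
      using N B by (intro add) auto
    also have "\<dots> \<le> s"
      unfolding s_def using N B by (intro cSUP_upper bdd null_sets.Un) auto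
    finally have "f (B - N) \<le> 0"
      using \<open>s \<le> f N\<close> by simp
    moreover have "0 \<le> f (B - N)"
      using N B by (intro nonneg) auto
    ultimately show "f (B - N) = 0"
      by simp
  qed (rule N)
qed

section \<open>Lebesgue densities and the lower bound for their variation\<close>

lemma borel_subsets_open:
  assumes "open \<Omega>"
  shows "borel_subsets \<Omega> = {A \<in> sets borel. A \<subseteq> \<Omega>}"
  using assms by (auto simp: sets_restrict_space)

lemma set_integrable_lebesgue_on:
  fixes w :: "'a::euclidean_space \<Rightarrow> 'b::euclidean_space"
  assumes "open \<Omega>" "integrable (lebesgue_on \<Omega>) w" "A \<in> sets lebesgue" "A \<subseteq> \<Omega>"
  shows "set_integrable lebesgue A w"
proof -
  have "set_integrable lebesgue \<Omega> w"
    using assms(1,2) by (simp add: integrable_restrict_space set_integrable_def)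
  then show ?thesis
    by (rule set_integrable_subset) (use assms in auto)
qed

lemma nn_integral_norm_eq_integral:
  fixes w :: "'a \<Rightarrow> 'b::{banach, second_countable_topology}"
  assumes "set_integrable M A w"
  shows "(\<integral>\<^sup>+x\<in>A. ennreal (norm (w x)) \<partial>M) = ennreal (LINT x:A|M. norm (w x))"
  unfolding set_lebesgue_integral_def
  using set_integrable_norm[OF assms]
  by (subst nn_integral_eq_integral[symmetric])
    (auto simp: set_integrable_def intro!: nn_integral_cong split: split_indicator)

text \<open>Integrability on \<open>A\<close> gives measurability only of \<open>w\<close> cut off
  outside \<open>A\<close>, so countable additivity of the integral is applied to the cut-off
  function.\<close>

lemma nn_integral_norm_partition:
  fixes w :: "'a \<Rightarrow> 'b::{banach, second_countable_topology}"
  assumes w: "set_integrable M A w"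
    and E: "\<And>k::nat. E k \<in> sets M" "disjoint_family E" "(\<Union>k. E k) = A"
  shows "(\<integral>\<^sup>+x\<in>A. ennreal (norm (w x)) \<partial>M) = (\<Sum>k. \<integral>\<^sup>+x\<in>E k. ennreal (norm (w x)) \<partial>M)"
proof -
  let ?f = "\<lambda>x. ennreal (norm (indicator A x *\<^sub>R w x))"
  have "(\<lambda>x. indicator A x *\<^sub>R w x) \<in> borel_measurable M"
    using w unfolding set_integrable_def by (rule borel_measurable_integrable)
  then have f: "?f \<in> borel_measurable M"
    by measurable
  have E_sub: "E k \<subseteq> A" for k
    unfolding E(3)[symmetric] by (rule UN_upper) simp
  have "(\<integral>\<^sup>+x\<in>A. ennreal (norm (w x)) \<partial>M) = (\<integral>\<^sup>+x\<in>(\<Union>k. E k). ?f x \<partial>M)"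
    unfolding E(3) by (intro nn_integral_cong) (auto split: split_indicator)
  also have "\<dots> = (\<Sum>k. \<integral>\<^sup>+x\<in>E k. ?f x \<partial>M)"
    by (rule nn_integral_disjoint_family[OF f E(1,2)])
  also have "\<dots> = (\<Sum>k. \<integral>\<^sup>+x\<in>E k. ennreal (norm (w x)) \<partial>M)"
    using E_sub by (intro suminf_cong nn_integral_cong) (auto split: split_indicator)
  finally show ?thesis .
qed

text \<open>
  On the preimage of a ball of radius \<open>\<epsilon>\<close> the function \<open>h\<close> is almost constant, so that the norm of
  its integral almost equals the integral of its norm. Countably many such balls cover the range.
\<close>

lemma nn_integral_norm_le_variation:
  fixes h :: "'a::euclidean_space \<Rightarrow> 'b::euclidean_space"
  assumes "open \<Omega>" "bounded \<Omega>" and int: "integrable (lebesgue_on \<Omega>) h" and A: "A \<in> borel_subsets \<Omega>"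
  shows "(\<integral>\<^sup>+x\<in>A. ennreal (norm (h x)) \<partial>lebesgue) \<le> variation \<Omega> (lebesgue_density h) A"
proof (rule ennreal_le_epsilon)
  fix e :: real
  assume "e > 0"
  have A': "A \<in> sets borel" "A \<subseteq> \<Omega>"
    using A \<open>open \<Omega>\<close> by (auto simp: borel_subsets_open)
  have A_leb [measurable]: "A \<in> sets lebesgue"
    using A' by auto
  have "A \<in> lmeasurable"
    using A' \<open>bounded \<Omega>\<close> by (intro bounded_set_imp_lmeasurable) (auto intro: bounded_subset)
  \<comment> \<open>Chosen so that the total error, at most \<open>2 * \<epsilon>\<close> times the
    measure of \<open>A\<close>, stays below \<open>e\<close>; the summand 1 covers sets of measure
    zero.\<close>
  define \<epsilon> where "\<epsilon> = e / (2 * measure lebesgue A + 1)"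
  have "\<epsilon> > 0" and \<epsilon>: "2 * \<epsilon> * measure lebesgue A \<le> e"
    using \<open>e > 0\<close> by (auto simp: \<epsilon>_def field_simps add_pos_nonneg)
  obtain Q :: "'b set" where Q: "countable Q" "\<And>X. open X \<Longrightarrow> X \<noteq> {} \<Longrightarrow> \<exists>d\<in>Q. d \<in> X"
    by (rule countable_dense_setE) blast
  have "Q \<noteq> {}"
    using Q(2)[of UNIV] by auto
  define q where "q = from_nat_into Q"
  have q: "\<exists>k. y \<in> ball (q k) \<epsilon>" for y
  proof -
    obtain d where "d \<in> Q" "d \<in> ball y \<epsilon>"
      using Q(2)[of "ball y \<epsilon>"] \<open>\<epsilon> > 0\<close> by auto
    moreover from \<open>d \<in> Q\<close> obtain k where "d = q k"
      using from_nat_into_surj[OF Q(1)] unfolding q_def by metis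
    ultimately show ?thesis
      by (auto simp: dist_commute)
  qed
  define C where "C = disjointed (\<lambda>k. ball (q k) \<epsilon>)"
  have "range C \<subseteq> sets borel"
    unfolding C_def by (rule sets.range_disjointed_sets) auto
  then have C_sets: "C k \<in> sets borel" for k
    by auto
  have C_dist: "dist (q k) y < \<epsilon>" if "y \<in> C k" for k y
    using that disjointed_subset[of "\<lambda>k. ball (q k) \<epsilon>" k] by (auto simp: C_def)
  have C_UN: "(\<Union>k. C k) = UNIV"
    unfolding C_def UN_disjointed_eq using q by blast
  define E where "E k = A \<inter> h -` C k" for k
  have E_sub: "E k \<subseteq> A" for k
    by (auto simp: E_def)
  have E_UN: "(\<Union>k. E k) = A"
  proof -
    have "\<exists>k. h x \<in> C k" for x
      using C_UN by blast
    then show ?thesis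
      by (auto simp: E_def)
  qed
  have E_dis: "disjoint_family E"
    using disjoint_family_disjointed[of "\<lambda>k. ball (q k) \<epsilon>"]
    unfolding C_def[symmetric] E_def disjoint_family_on_def by blast
  have E_leb [measurable]: "E k \<in> sets lebesgue" for k
  proof -
    have "h -` C k \<inter> space (lebesgue_on \<Omega>) \<in> sets (lebesgue_on \<Omega>)"
      by (rule measurable_sets[OF borel_measurable_integrable[OF int] C_sets])
    then have "h -` C k \<inter> \<Omega> \<in> sets lebesgue"
      using \<open>open \<Omega>\<close> by (auto simp: sets_restrict_space_iff)
    moreover have "E k = A \<inter> (h -` C k \<inter> \<Omega>)"
      using A' by (auto simp: E_def)
    ultimately show ?thesis
      using A_leb by (simp add: sets.Int)
  qed
  \<comment> \<open>The pieces \<open>E k\<close> are only Lebesgue measurable, but the variation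
    admits only Borel pieces; \<open>main_part\<close> is a Borel set inside \<open>E k\<close> that
    misses just a null set.\<close>
  define S where "S k = main_part lborel (E k)" for k
  have S_sub: "S k \<subseteq> E k" for k
    unfolding S_def using main_part_null_part_Un[OF E_leb, of k] by blast
  have S_borel: "S k \<in> sets borel" for k
    unfolding S_def using main_part_sets[OF E_leb] by simp
  have S_null: "E k - S k \<in> null_sets lebesgue" for k
  proof -
    have "E k - S k = null_part lborel (E k)"
      unfolding S_def using main_part_null_part_Un[OF E_leb, of k] main_part_null_part_Int[OF E_leb, of k] by blast
    moreover have "null_part lborel (E k) \<in> null_sets lebesgue"
      using null_part[OF E_leb] by (auto simp: null_sets_completion_iff2)
    ultimately show ?thesis
      by simp
  qed
  have S: "S k \<in> borel_subsets \<Omega>" for k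
    using S_sub S_borel E_sub A' \<open>open \<Omega>\<close> by (fastforce simp: borel_subsets_open)
  have dens_S: "lebesgue_density h (S k) = (LINT x:E k|lebesgue. h x)" for k
    unfolding lebesgue_density_def set_lebesgue_integral_def
  proof (rule integral_cong_AE)
    have "set_integrable lebesgue (S k) h"
      by (rule set_integrable_lebesgue_on[OF \<open>open \<Omega>\<close> int])
        (use A' E_sub[of k] S_sub[of k] S_borel[of k] in auto)
    moreover have "set_integrable lebesgue (E k) h"
      by (rule set_integrable_lebesgue_on[OF \<open>open \<Omega>\<close> int]) (use A' E_sub[of k] in auto)
    ultimately show "(\<lambda>x. indicator (S k) x *\<^sub>R h x) \<in> borel_measurable lebesgue"
      "(\<lambda>x. indicator (E k) x *\<^sub>R h x) \<in> borel_measurable lebesgue"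
      by (auto simp: set_integrable_def)
    show "AE x in lebesgue. indicator (S k) x *\<^sub>R h x = indicator (E k) x *\<^sub>R h x"
      using AE_not_in[OF S_null[of k]] S_sub[of k] by (auto elim!: eventually_mono split: split_indicator)
  qed
  \<comment> \<open>One \<epsilon> pays for replacing the norm of \<open>h\<close> by that of
    \<open>q k\<close>, the other for replacing the integral of \<open>h\<close> by that of the
    constant \<open>q k\<close>.\<close>
  have bound: "(\<integral>\<^sup>+x\<in>E k. ennreal (norm (h x)) \<partial>lebesgue) \<le>
    ennreal (norm (lebesgue_density h (S k))) + ennreal (2 * \<epsilon>) * emeasure lebesgue (E k)" for k
  proof -
    let ?m = "measure lebesgue (E k)"
    have E_lm: "E k \<in> lmeasurable"
      using \<open>A \<in> lmeasurable\<close> E_leb E_sub by (metis fmeasurableI2)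
    have ih: "set_integrable lebesgue (E k) h"
      using assms A' E_sub by (intro set_integrable_lebesgue_on[OF \<open>open \<Omega>\<close>]) auto
    have ic: "set_integrable lebesgue (E k) (\<lambda>_. c)" for c :: "'c::euclidean_space"
      using E_lm by (simp add: set_integrable_def fmeasurable_def)
    have c: "(LINT x:E k|lebesgue. c) = ?m *\<^sub>R c" for c :: "'c::euclidean_space"
      using E_lm by (simp add: set_lebesgue_integral_def fmeasurable_def)
    have id: "set_integrable lebesgue (E k) (\<lambda>x. h x - q k)"
      by (intro set_integral_diff ih ic)
    have close: "norm (h x - q k) \<le> \<epsilon>" if "x \<in> E k" for x
      using that C_dist[of "h x" k] by (auto simp: E_def dist_norm norm_minus_commute)
    have "(LINT x:E k|lebesgue. norm (h x)) \<le> (LINT x:E k|lebesgue. norm (q k) + \<epsilon>)"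
    proof (rule set_integral_mono)
      show "norm (h x) \<le> norm (q k) + \<epsilon>" if "x \<in> E k" for x
        using close[OF that] norm_triangle_sub[of "h x" "q k"] by linarith
    qed (intro set_integrable_norm ih ic)+
    also have "\<dots> = norm (?m *\<^sub>R q k) + \<epsilon> * ?m"
      unfolding c by (simp add: algebra_simps)
    also have "?m *\<^sub>R q k = (LINT x:E k|lebesgue. h x) - (LINT x:E k|lebesgue. h x - q k)"
      unfolding set_integral_diff(2)[OF ih ic] c by simp
    also have "norm \<dots> \<le> norm (LINT x:E k|lebesgue. h x) + norm (LINT x:E k|lebesgue. h x - q k)"
      by (rule norm_triangle_ineq4)
    also have "norm (LINT x:E k|lebesgue. h x - q k) \<le> (LINT x:E k|lebesgue. norm (h x - q k))"
      by (rule set_integral_norm_bound[OF id])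
    also have "\<dots> \<le> (LINT x:E k|lebesgue. \<epsilon>)"
      by (intro set_integral_mono set_integrable_norm id ic close)
    also have "\<dots> = \<epsilon> * ?m"
      unfolding c by simp
    finally have "(LINT x:E k|lebesgue. norm (h x)) \<le> norm (lebesgue_density h (S k)) + 2 * \<epsilon> * ?m"
      by (simp add: dens_S algebra_simps)
    moreover have "ennreal (2 * \<epsilon>) * emeasure lebesgue (E k) = ennreal (2 * \<epsilon> * ?m)"
      unfolding emeasure_eq_measure2[OF E_lm] using \<open>\<epsilon> > 0\<close> by (simp add: ennreal_mult)
    ultimately show ?thesis
      unfolding nn_integral_norm_eq_integral[OF ih]
      using \<open>\<epsilon> > 0\<close> by (simp flip: ennreal_plus)
  qed
  have "(\<integral>\<^sup>+x\<in>A. ennreal (norm (h x)) \<partial>lebesgue) = (\<Sum>k. \<integral>\<^sup>+x\<in>E k. ennreal (norm (h x)) \<partial>lebesgue)"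
    using A' by (intro nn_integral_norm_partition set_integrable_lebesgue_on[OF \<open>open \<Omega>\<close> int] E_dis E_UN) auto
  also have "\<dots> \<le> (\<Sum>k. ennreal (norm (lebesgue_density h (S k))) + ennreal (2 * \<epsilon>) * emeasure lebesgue (E k))"
    by (intro suminf_le bound) auto
  also have "\<dots> = (\<Sum>k. ennreal (norm (lebesgue_density h (S k)))) + ennreal (2 * \<epsilon>) * (\<Sum>k. emeasure lebesgue (E k))"
    by (subst suminf_add[symmetric]) auto
  also have "(\<Sum>k. emeasure lebesgue (E k)) = emeasure lebesgue A"
    using E_dis E_leb by (subst suminf_emeasure) (auto simp: E_UN)
  finally have "(\<integral>\<^sup>+x\<in>A. ennreal (norm (h x)) \<partial>lebesgue) \<le>
      (\<Sum>k. ennreal (norm (lebesgue_density h (S k)))) + ennreal (2 * \<epsilon>) * emeasure lebesgue A" .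
  moreover have "ennreal (2 * \<epsilon>) * emeasure lebesgue A \<le> ennreal e"
    unfolding emeasure_eq_measure2[OF \<open>A \<in> lmeasurable\<close>]
    using \<epsilon> \<open>\<epsilon> > 0\<close> by (simp add: ennreal_leI flip: ennreal_mult')
  moreover have "(\<Sum>k. ennreal (norm (lebesgue_density h (S k)))) \<le> variation \<Omega> (lebesgue_density h) A"
  proof -
    have "disjoint_family S"
      unfolding disjoint_family_on_def
    proof (intro ballI impI)
      fix i j :: nat assume "i \<noteq> j"
      then show "S i \<inter> S j = {}"
        using disjoint_family_onD[OF E_dis, of i j] S_sub[of i] S_sub[of j] by auto
    qed
    then have "(\<Sum>k. ennreal (norm (lebesgue_density h (S k)))) \<le> variation \<Omega> (lebesgue_density h) (\<Union>k. S k)"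
      using S by (intro suminf_norm_le_variation) auto
    \<comment> \<open>The sets \<open>S k\<close> exhaust \<open>A\<close> only up to a null set, so
      they partition a subset of \<open>A\<close> and monotonicity has to close the gap.\<close>
    also have "\<dots> \<le> variation \<Omega> (lebesgue_density h) A"
    proof (rule variation_mono[OF _ A])
      show "(\<Union>k. S k) \<in> borel_subsets \<Omega>"
        using S by (intro sets.countable_UN) auto
      show "(\<Union>k. S k) \<subseteq> A"
        using S_sub E_sub by (intro UN_least) (rule order_trans)
    qed
    finally show ?thesis .
  qed
  ultimately show "(\<integral>\<^sup>+x\<in>A. ennreal (norm (h x)) \<partial>lebesgue) \<le> variation \<Omega> (lebesgue_density h) A + ennreal e"
    by (meson add_mono order_trans)
qed

section \<open>Unions, sums and restrictions under the variation\<close>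

text \<open>The constant sequence of empty sets is disjoint, and a constant series converges only if
  its term is zero.\<close>

lemma finite_radon_measure_empty:
  assumes "finite_radon_measure \<Omega> \<mu>"
  shows "\<mu> {} = 0"
proof -
  have "(\<lambda>_. \<mu> {}) sums \<mu> {}"
    using finite_radon_measure_sums[OF assms, of "\<lambda>_. {}"] by (simp add: disjoint_family_on_def)
  then show ?thesis
    by (simp add: sums_iff summable_const_iff)
qed

lemma variation_Un:
  assumes fin: "finite_radon_measure \<Omega> \<mu>"
    and A: "A \<in> borel_subsets \<Omega>" and B: "B \<in> borel_subsets \<Omega>" and "A \<inter> B = {}"
  shows "variation \<Omega> \<mu> (A \<union> B) = variation \<Omega> \<mu> A + variation \<Omega> \<mu> B"
proof -
  \<comment> \<open>From index 2 on, \<open>binaryset\<close> consists of empty sets, whose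
    variation must not contribute.\<close>
  have "variation \<Omega> \<mu> {} \<le> 0"
    using finite_radon_measure_empty[OF fin] by (intro variation_leI) auto
  then have "(\<Sum>n. variation \<Omega> \<mu> (binaryset A B n)) = variation \<Omega> \<mu> A + variation \<Omega> \<mu> B"
    by (intro suminf_binaryset_eq) simp
  moreover have "(\<Sum>n. variation \<Omega> \<mu> (binaryset A B n)) = variation \<Omega> \<mu> (A \<union> B)"
    unfolding UN_binaryset_eq[symmetric] using assms
    by (intro variation_additive[OF fin]) (auto simp: range_binaryset_eq disjoint_family_on_def binaryset_def)
  ultimately show ?thesis
    by simp
qed

text \<open>A setwise bound passes to the sums over each partition. Stated through norms, it serves
  sums and differences of measures alike.\<close>

lemma variation_triangle:
  assumes "\<And>A. A \<in> borel_subsets \<Omega> \<Longrightarrow> norm (\<rho> A) \<le> norm (\<mu> A) + norm (\<nu> A)"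
  shows "variation \<Omega> \<rho> X \<le> variation \<Omega> \<mu> X + variation \<Omega> \<nu> X"
proof (rule variation_leI)
  fix E :: "nat \<Rightarrow> 'a set"
  assume E: "range E \<subseteq> borel_subsets \<Omega>" "disjoint_family E" "(\<Union>i. E i) = X"
  then have "(\<Sum>i. ennreal (norm (\<rho> (E i)))) \<le> (\<Sum>i. ennreal (norm (\<mu> (E i))) + ennreal (norm (\<nu> (E i))))"
    by (intro suminf_le) (auto simp: assms range_subsetD simp flip: ennreal_plus intro!: ennreal_leI)
  also have "\<dots> = (\<Sum>i. ennreal (norm (\<mu> (E i)))) + (\<Sum>i. ennreal (norm (\<nu> (E i))))"
    by (rule suminf_add[symmetric]) auto
  also have "\<dots> \<le> variation \<Omega> \<mu> X + variation \<Omega> \<nu> X"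
    by (intro add_mono suminf_norm_le_variation E)
  finally show "(\<Sum>i. ennreal (norm (\<rho> (E i)))) \<le> variation \<Omega> \<mu> X + variation \<Omega> \<nu> X" .
qed

text \<open>Removing \<open>N\<close> from each piece turns a partition of \<open>X\<close> into one
  of \<open>X - N\<close>.\<close>

lemma variation_Diff_le:
  assumes "N \<in> borel_subsets \<Omega>"
  shows "variation \<Omega> (\<lambda>A. \<mu> (A - N)) X \<le> variation \<Omega> \<mu> (X - N)"
proof (rule variation_leI)
  fix E :: "nat \<Rightarrow> 'a set"
  assume E: "range E \<subseteq> borel_subsets \<Omega>" "disjoint_family E" "(\<Union>i. E i) = X"
  show "(\<Sum>i. ennreal (norm (\<mu> (E i - N)))) \<le> variation \<Omega> \<mu> (X - N)"
  proof (rule suminf_norm_le_variation)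
    show "range (\<lambda>i. E i - N) \<subseteq> borel_subsets \<Omega>"
      using E(1) assms by (auto simp: range_subsetD)
    show "disjoint_family (\<lambda>i. E i - N)"
      using disjoint_family_onD[OF E(2)] by (fastforce simp: disjoint_family_on_def)
    show "(\<Union>i. E i - N) = X - N"
      using E(3) by auto
  qed
qed

section \<open>Existence of the Lebesgue decomposition of a vector measure\<close>

text \<open>Radon-Nikodym densities arise over \<open>lborel\<close>, whereas
  \<open>lebesgue_density\<close> integrates over its completion; for Borel measurable functions the
  two integrals agree.\<close>

lemma lebesgue_density_lborel:
  fixes w :: "'a::euclidean_space \<Rightarrow> 'b::euclidean_space"
  assumes "open \<Omega>" and w: "integrable (restrict_space lborel \<Omega>) w"
  shows "integrable (lebesgue_on \<Omega>) w"
    and "A \<in> borel_subsets \<Omega> \<Longrightarrow> lebesgue_density w A = (LINT x:A|restrict_space lborel \<Omega>. w x)"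
proof -
  have int: "integrable lborel (\<lambda>x. indicator \<Omega> x *\<^sub>R w x)"
    using w \<open>open \<Omega>\<close> by (simp add: integrable_restrict_space)
  then have "integrable lebesgue (\<lambda>x. indicator \<Omega> x *\<^sub>R w x)"
    using borel_measurable_integrable[OF int] by (simp add: integrable_completion)
  then show "integrable (lebesgue_on \<Omega>) w"
    using \<open>open \<Omega>\<close> by (simp add: integrable_restrict_space)
  assume "A \<in> borel_subsets \<Omega>"
  then have A: "A \<in> sets borel" "A \<subseteq> \<Omega>"
    using borel_subsets_open[OF \<open>open \<Omega>\<close>] by auto
  have "lebesgue_density w A = (LINT x|lebesgue. indicator A x *\<^sub>R (indicator \<Omega> x *\<^sub>R w x))"
    unfolding lebesgue_density_def set_lebesgue_integral_def using A
    by (intro Bochner_Integration.integral_cong) (auto split: split_indicator)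
  also have "\<dots> = (LINT x|lborel. indicator A x *\<^sub>R (indicator \<Omega> x *\<^sub>R w x))"
    using A
    by (intro integral_completion borel_measurable_scaleR[OF borel_measurable_indicator]
          borel_measurable_integrable[OF int]) auto
  also have "\<dots> = (LINT x:A|restrict_space lborel \<Omega>. w x)"
    unfolding set_lebesgue_integral_def using \<open>open \<Omega>\<close>
    by (subst integral_restrict_space) (auto simp: mult.commute)
  finally show "lebesgue_density w A = (LINT x:A|restrict_space lborel \<Omega>. w x)" .
qed

text \<open>
  With \<open>l = |\<mu>|\<close> and \<open>N\<close> a Lebesgue null set carrying the singular part of \<open>l\<close>, the restriction to
  the complement of \<open>N\<close> of each component of \<open>\<mu>\<close> is a difference of the absolutely continuous
  positive measures \<open>l + \<mu> \<bullet> i\<close> and \<open>l\<close>; no Hahn decomposition is needed.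
\<close>

lemma lebesgue_decomposition_exists:
  fixes \<mu> :: "'a::euclidean_space set \<Rightarrow> 'b::euclidean_space"
  assumes "open \<Omega>" "bounded \<Omega>" and fin: "finite_radon_measure \<Omega> \<mu>"
  shows "\<exists>g \<nu>. lebesgue_decomposition \<Omega> \<mu> g \<nu>"
proof -
  \<comment> \<open>Over \<open>lborel\<close> the measurable sets are exactly the Borel subsets of
    \<Omega>, on which \<open>\<mu>\<close> is known to be additive.\<close>
  define M where "M = restrict_space (lborel :: 'a measure) \<Omega>"
  have sets_M: "sets M = borel_subsets \<Omega>"
    unfolding M_def by (rule sets_restrict_space_cong) simp
  have "emeasure lborel \<Omega> < \<infinity>"
    using \<open>bounded \<Omega>\<close> by (rule emeasure_bounded_finite)
  then have "finite_measure M"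
    unfolding M_def using \<open>open \<Omega>\<close> by (intro finite_measureI) (simp add: emeasure_restrict_space)
  have \<Omega>: "\<Omega> \<in> sets M"
    using \<open>open \<Omega>\<close> by (simp add: sets_M borel_subsets_open)
  have M_sub: "A \<subseteq> \<Omega>" if "A \<in> sets M" for A
    using that \<open>open \<Omega>\<close> by (simp add: sets_M borel_subsets_open)
  have M_UN: "(\<Union>n. A n) \<in> sets M" if "\<And>n. A n \<in> sets M" for A :: "nat \<Rightarrow> 'a set"
    using that by (intro sets.countable_UN) auto
  define l where "l A = enn2real (variation \<Omega> \<mu> A)" for A
  have l: "ennreal (l A) = variation \<Omega> \<mu> A" if "A \<in> sets M" for A
  proof -
    have "variation \<Omega> \<mu> A \<le> variation \<Omega> \<mu> \<Omega>"
      using that \<Omega> M_sub unfolding sets_M by (intro variation_mono) auto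
    also have "\<dots> < \<infinity>"
      using fin by (simp add: finite_radon_measure_def)
    finally show ?thesis
      by (simp add: l_def less_top)
  qed
  have l_nonneg: "0 \<le> l A" for A
    by (simp add: l_def)
  have l_sums: "(\<lambda>i. l (A i)) sums l (\<Union>i. A i)"
    if A: "\<And>n. A n \<in> sets M" "disjoint_family A" for A :: "nat \<Rightarrow> 'a set"
  proof -
    have "(\<lambda>i. ennreal (l (A i))) sums ennreal (l (\<Union>i. A i))"
      unfolding l[OF A(1)] l[OF M_UN[OF A(1)]]
      using A by (subst variation_additive[OF fin, symmetric]) (auto simp: sets_M intro: summable_sums)
    then show ?thesis
      by (simp add: l_nonneg)
  qed
  have \<mu>_le: "\<bar>\<mu> A \<bullet> i\<bar> \<le> l A" if "A \<in> sets M" "i \<in> Basis" for A i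
  proof -
    have "ennreal (norm (\<mu> A)) \<le> ennreal (l A)"
      using that norm_le_variation[of A \<Omega> \<mu>] by (simp add: l sets_M)
    then have "norm (\<mu> A) \<le> l A"
      by (simp add: l_nonneg ennreal_le_iff)
    then show ?thesis
      using Basis_le_norm[OF that(2), of "\<mu> A"] by linarith
  qed
  obtain N where N: "N \<in> null_sets M" and lN: "\<And>A. A \<in> null_sets M \<Longrightarrow> l (A - N) = 0"
  proof (rule exhausting_null_set[of M l])
    fix A B assume AB: "A \<in> sets M" "B \<in> sets M" "A \<inter> B = {}"
    then have "ennreal (l A + l B) \<le> ennreal (l (A \<union> B))"
      using variation_superadditive[of A \<Omega> B \<mu>] by (simp add: l l_nonneg ennreal_plus sets_M)
    then show "l A + l B \<le> l (A \<union> B)"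
      using ennreal_le_iff[OF l_nonneg] by blast
  qed (use l_nonneg in auto)
  have N_M: "N \<in> sets M"
    using N by auto
  have diff_sets: "A - N \<in> sets M" if "A \<in> sets M" for A
    using that N_M by auto
  have diff_fam: "disjoint_family (\<lambda>i. A i - N)" if "disjoint_family A" for A :: "nat \<Rightarrow> 'a set"
    using disjoint_family_onD[OF that] by (fastforce simp: disjoint_family_on_def)
  have l_sums': "(\<lambda>i. l (A i - N)) sums l ((\<Union>i. A i) - N)"
    if "range A \<subseteq> sets M" "disjoint_family A" for A :: "nat \<Rightarrow> 'a set"
    using l_sums[of "\<lambda>i. A i - N"] that diff_sets diff_fam by (simp add: range_subsetD)
  have \<mu>_sums': "(\<lambda>i. \<mu> (A i - N)) sums \<mu> ((\<Union>i. A i) - N)"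
    if "range A \<subseteq> sets M" "disjoint_family A" for A :: "nat \<Rightarrow> 'a set"
    using finite_radon_measure_sums[OF fin, of "\<lambda>i. A i - N"] that diff_sets diff_fam
    by (simp add: range_subsetD flip: sets_M)
  obtain L where L: "integrable M L" "\<And>A. A \<in> sets M \<Longrightarrow> l (A - N) = (LINT x:A|M. L x)"
    using real_Radon_Nikodym[OF \<open>finite_measure M\<close>, of "\<lambda>A. l (A - N)"] l_nonneg l_sums' lN by metis
  have "\<exists>G. integrable M G \<and> (\<forall>A\<in>sets M. l (A - N) + \<mu> (A - N) \<bullet> i = (LINT x:A|M. G x))"
    if i: "i \<in> Basis" for i
  proof (rule real_Radon_Nikodym[OF \<open>finite_measure M\<close>, of "\<lambda>A. l (A - N) + \<mu> (A - N) \<bullet> i"])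
    show "0 \<le> l (A - N) + \<mu> (A - N) \<bullet> i" if "A \<in> sets M" for A
      using \<mu>_le[OF diff_sets[OF that] i] by linarith
    \<comment> \<open>On a null set the choice of \<open>N\<close> makes \<open>l (A - N)\<close>
      vanish, and \<open>l\<close> dominates every component of \<open>\<mu>\<close>.\<close>
    show "l (A - N) + \<mu> (A - N) \<bullet> i = 0" if "A \<in> null_sets M" for A
      using \<mu>_le[OF diff_sets i, of A] lN[OF that] that by auto
    show "(\<lambda>n. l (A n - N) + \<mu> (A n - N) \<bullet> i) sums (l ((\<Union>n. A n) - N) + \<mu> ((\<Union>n. A n) - N) \<bullet> i)"
      if "range A \<subseteq> sets M" "disjoint_family A" for A :: "nat \<Rightarrow> 'a set"
      using that by (intro sums_add l_sums' bounded_linear.sums[OF bounded_linear_inner_left] \<mu>_sums')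
  qed auto
  then obtain G where G: "\<And>i. i \<in> Basis \<Longrightarrow> integrable M (G i)"
    "\<And>i A. i \<in> Basis \<Longrightarrow> A \<in> sets M \<Longrightarrow> l (A - N) + \<mu> (A - N) \<bullet> i = (LINT x:A|M. G i x)"
    by metis
  \<comment> \<open>Subtracting the density \<open>L\<close> of \<open>l\<close> undoes the shift
    that made each component nonnegative.\<close>
  define g where "g x = (\<Sum>i\<in>Basis. (G i x - L x) *\<^sub>R i)" for x
  have g_int: "integrable M g"
    unfolding g_def using G(1) L(1) by auto
  have dens: "\<mu> (A - N) = lebesgue_density g A" if A: "A \<in> sets M" for A
  proof (rule euclidean_eqI)
    fix i :: 'b assume i: "i \<in> Basis"
    have sint: "set_integrable M A f" if "integrable M f" for f :: "'a \<Rightarrow> real"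
      unfolding set_integrable_def by (rule integrable_mult_indicator[OF A that])
    have "lebesgue_density g A \<bullet> i = (LINT x:A|M. g x) \<bullet> i"
      using lebesgue_density_lborel(2)[OF \<open>open \<Omega>\<close>, of g A] g_int A
      unfolding M_def[symmetric] sets_M by simp
    also have "\<dots> = (LINT x:A|M. G i x - L x)"
      unfolding set_lebesgue_integral_def using i
      by (subst integral_inner_left[symmetric])
        (auto simp: g_def inner_sum_left_Basis intro!: integrable_mult_indicator A g_int[unfolded g_def])
    also have "\<dots> = (LINT x:A|M. G i x) - (LINT x:A|M. L x)"
      using i by (intro set_integral_diff sint G L)
    also have "\<dots> = \<mu> (A - N) \<bullet> i"
      using G(2)[OF i A] L(2)[OF A] by simp
    finally show "\<mu> (A - N) \<bullet> i = lebesgue_density g A \<bullet> i"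
      by simp
  qed
  have N': "N \<in> borel_subsets \<Omega>"
    using N_M sets_M by simp
  \<comment> \<open>By additivity this is \<open>\<mu> (A \<inter> N)\<close>; in difference form,
    countable additivity and finite variation are inherited from the two terms.\<close>
  define \<nu> where "\<nu> A = \<mu> A - \<mu> (A - N)" for A
  have "variation \<Omega> \<nu> \<Omega> \<le> variation \<Omega> \<mu> \<Omega> + variation \<Omega> (\<lambda>A. \<mu> (A - N)) \<Omega>"
    unfolding \<nu>_def by (intro variation_triangle norm_triangle_ineq4)
  also have "\<dots> \<le> variation \<Omega> \<mu> \<Omega> + variation \<Omega> \<mu> (\<Omega> - N)"
    by (intro add_left_mono variation_Diff_le N')
  also have "\<dots> < \<infinity>"
    using \<Omega> N_M by (simp add: ennreal_add_less_top flip: l)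
  finally have "variation \<Omega> \<nu> \<Omega> < \<infinity>" .
  moreover have "(\<lambda>i. \<nu> (E i)) sums \<nu> (\<Union>i. E i)"
    if "range E \<subseteq> borel_subsets \<Omega>" "disjoint_family E" for E :: "nat \<Rightarrow> 'a set"
    unfolding \<nu>_def using that finite_radon_measure_sums[OF fin]
    by (intro sums_diff \<mu>_sums') (auto simp: sets_M range_subsetD)
  ultimately have "finite_radon_measure \<Omega> \<nu>"
    by (simp add: finite_radon_measure_def)
  moreover have "variation \<Omega> \<nu> (\<Omega> - N) = variation \<Omega> (\<lambda>_. 0 :: 'b) (\<Omega> - N)"
  proof (rule variation_cong)
    fix B assume "B \<subseteq> \<Omega> - N"
    then have "B - N = B"
      by auto
    then show "\<nu> B = 0"
      by (simp add: \<nu>_def)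
  qed
  then have "variation \<Omega> \<nu> (\<Omega> - N) = 0"
    using variation_leI[of \<Omega> "\<Omega> - N" "\<lambda>_. 0 :: 'b" 0] by simp
  then have "singular_measure \<Omega> \<nu>"
    unfolding singular_measure_def using N N' \<open>open \<Omega>\<close>
    by (intro bexI[of _ N]) (auto simp: M_def null_sets_restrict_space intro: null_sets_completionI)
  moreover have "integrable (lebesgue_on \<Omega>) g"
    using lebesgue_density_lborel(1)[OF \<open>open \<Omega>\<close>] g_int by (simp add: M_def)
  moreover have "\<mu> A = lebesgue_density g A + \<nu> A" if "A \<in> borel_subsets \<Omega>" for A
    using dens[of A] that by (simp add: \<nu>_def sets_M)
  ultimately have "lebesgue_decomposition \<Omega> \<mu> g \<nu>"
    by (simp add: lebesgue_decomposition_def)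
  then show ?thesis
    by blast
qed

section \<open>The norm of a density plus a singular measure\<close>

text \<open>The upper bound sums, over the pieces of a partition, the estimate of the norm of an
  integral by the integral of the norm; the lower bound is the approximation by almost constant
  pieces.\<close>

lemma variation_lebesgue_density:
  fixes h :: "'a::euclidean_space \<Rightarrow> 'b::euclidean_space"
  assumes "open \<Omega>" "bounded \<Omega>" and int: "integrable (lebesgue_on \<Omega>) h" and A: "A \<in> borel_subsets \<Omega>"
  shows "variation \<Omega> (lebesgue_density h) A = (\<integral>\<^sup>+x\<in>A. ennreal (norm (h x)) \<partial>lebesgue)"
proof (rule antisym)
  show "variation \<Omega> (lebesgue_density h) A \<le> (\<integral>\<^sup>+x\<in>A. ennreal (norm (h x)) \<partial>lebesgue)"
  proof (rule variation_leI)
    fix E :: "nat \<Rightarrow> 'a set"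
    assume E: "range E \<subseteq> borel_subsets \<Omega>" "disjoint_family E" "(\<Union>i. E i) = A"
    have bs: "B \<in> sets lebesgue" "B \<subseteq> \<Omega>" if "B \<in> borel_subsets \<Omega>" for B
      using that by (auto simp: borel_subsets_open[OF \<open>open \<Omega>\<close>])
    have sint: "set_integrable lebesgue B h" if "B \<in> borel_subsets \<Omega>" for B
      using bs[OF that] by (rule set_integrable_lebesgue_on[OF \<open>open \<Omega>\<close> int])
    have Ei: "E i \<in> borel_subsets \<Omega>" for i
      using E(1) by auto
    have "ennreal (norm (lebesgue_density h (E i))) \<le> (\<integral>\<^sup>+x\<in>E i. ennreal (norm (h x)) \<partial>lebesgue)" for i
      unfolding lebesgue_density_def nn_integral_norm_eq_integral[OF sint[OF Ei]]
      by (intro ennreal_leI set_integral_norm_bound sint Ei)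
    then have "(\<Sum>i. ennreal (norm (lebesgue_density h (E i)))) \<le> (\<Sum>i. \<integral>\<^sup>+x\<in>E i. ennreal (norm (h x)) \<partial>lebesgue)"
      by (intro suminf_le) auto
    also have "\<dots> = (\<integral>\<^sup>+x\<in>A. ennreal (norm (h x)) \<partial>lebesgue)"
      by (intro nn_integral_norm_partition[symmetric] sint A E bs Ei)
    finally show "(\<Sum>i. ennreal (norm (lebesgue_density h (E i)))) \<le> (\<integral>\<^sup>+x\<in>A. ennreal (norm (h x)) \<partial>lebesgue)" .
  qed
qed (rule nn_integral_norm_le_variation[OF assms])

text \<open>Off the null set \<open>N\<close> the measure \<open>\<rho>\<close> agrees with its
  density part, on \<open>N\<close> with \<open>\<nu>\<close>. Superadditivity over these two sets
  gives the lower bound, the triangle inequality the upper one.\<close>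

lemma variation_density_plus_singular:
  fixes h :: "'a::euclidean_space \<Rightarrow> 'b::euclidean_space"
  assumes "open \<Omega>" "bounded \<Omega>" and int: "integrable (lebesgue_on \<Omega>) h"
    and \<nu>: "finite_radon_measure \<Omega> \<nu>" and sing: "singular_measure \<Omega> \<nu>"
    and \<rho>: "\<And>A. A \<in> borel_subsets \<Omega> \<Longrightarrow> \<rho> A = lebesgue_density h A + \<nu> A"
  shows "variation \<Omega> \<rho> \<Omega> = ennreal (LINT x|lebesgue_on \<Omega>. norm (h x)) + variation \<Omega> \<nu> \<Omega>"
proof -
  obtain N where N: "N \<in> borel_subsets \<Omega>" "N \<in> null_sets lebesgue" "variation \<Omega> \<nu> (\<Omega> - N) = 0"
    using sing by (auto simp: singular_measure_def)
  have bs: "borel_subsets \<Omega> = {A \<in> sets borel. A \<subseteq> \<Omega>}"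
    by (rule borel_subsets_open[OF \<open>open \<Omega>\<close>])
  have \<Omega>: "\<Omega> \<in> borel_subsets \<Omega>" "\<Omega> - N \<in> borel_subsets \<Omega>"
    using N \<open>open \<Omega>\<close> by (auto simp: bs)
  have "(\<integral>\<^sup>+x\<in>\<Omega>. ennreal (norm (h x)) \<partial>lebesgue) = ennreal (LINT x:\<Omega>|lebesgue. norm (h x))"
    using \<open>open \<Omega>\<close> by (intro nn_integral_norm_eq_integral set_integrable_lebesgue_on[OF _ int]) auto
  also have "(LINT x:\<Omega>|lebesgue. norm (h x)) = (LINT x|lebesgue_on \<Omega>. norm (h x))"
    using \<open>open \<Omega>\<close> by (simp add: integral_restrict_space set_lebesgue_integral_def)
  finally have norm_h: "variation \<Omega> (lebesgue_density h) \<Omega> = ennreal (LINT x|lebesgue_on \<Omega>. norm (h x))"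
    using assms(1,2) int \<Omega> by (simp add: variation_lebesgue_density)
  have "variation \<Omega> \<rho> \<Omega> \<le> variation \<Omega> (lebesgue_density h) \<Omega> + variation \<Omega> \<nu> \<Omega>"
    by (intro variation_triangle) (simp add: \<rho> norm_triangle_ineq)
  moreover have "variation \<Omega> (lebesgue_density h) \<Omega> + variation \<Omega> \<nu> \<Omega> \<le> variation \<Omega> \<rho> \<Omega>"
  proof -
    have 1: "variation \<Omega> (lebesgue_density h) \<Omega> = variation \<Omega> \<rho> (\<Omega> - N)"
    proof -
      have "variation \<Omega> (lebesgue_density h) \<Omega> = (\<integral>\<^sup>+x\<in>\<Omega>. ennreal (norm (h x)) \<partial>lebesgue)"
        by (intro variation_lebesgue_density assms \<Omega>)
      also have "\<dots> = (\<integral>\<^sup>+x\<in>\<Omega> - N. ennreal (norm (h x)) \<partial>lebesgue)"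
        using AE_not_in[OF N(2)] by (intro nn_integral_cong_AE) (auto elim!: eventually_mono split: split_indicator)
      also have "\<dots> = variation \<Omega> (lebesgue_density h) (\<Omega> - N)"
        by (intro variation_lebesgue_density[symmetric] assms \<Omega>)
      also have "\<dots> = variation \<Omega> \<rho> (\<Omega> - N)"
      proof (rule variation_cong)
        fix B assume B: "B \<in> borel_subsets \<Omega>" "B \<subseteq> \<Omega> - N"
        have "ennreal (norm (\<nu> B)) \<le> variation \<Omega> \<nu> (\<Omega> - N)"
          using norm_le_variation[OF B(1)] variation_mono[OF B(1) \<Omega>(2) B(2)] by (rule order_trans)
        then show "lebesgue_density h B = \<rho> B"
          using N(3) B by (simp add: \<rho>)
      qed
      finally show ?thesis .
    qed
    have "\<Omega> = (\<Omega> - N) \<union> N"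
      using N(1) by (auto simp: bs)
    then have "variation \<Omega> \<nu> \<Omega> = variation \<Omega> \<nu> ((\<Omega> - N) \<union> N)"
      by simp
    \<comment> \<open>The variation of \<open>\<nu>\<close> on \<Omega> must be bounded from above
      by that on \<open>N\<close>; superadditivity points the other way, so additivity enters
      here.\<close>
    also have "\<dots> = variation \<Omega> \<nu> N"
      using N(3) by (subst variation_Un[OF \<nu> \<Omega>(2) N(1)]) auto
    also have "\<dots> = variation \<Omega> \<rho> N"
    proof (rule variation_cong)
      fix B assume B: "B \<in> borel_subsets \<Omega>" "B \<subseteq> N"
      have "lebesgue_density h B = 0"
        unfolding lebesgue_density_def set_lebesgue_integral_def using AE_not_in[OF N(2)] B(2)
        by (intro integral_eq_zero_AE) (auto elim!: eventually_mono split: split_indicator)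
      then show "\<nu> B = \<rho> B"
        using B by (simp add: \<rho>)
    qed
    finally have "variation \<Omega> (lebesgue_density h) \<Omega> + variation \<Omega> \<nu> \<Omega> \<le> variation \<Omega> \<rho> (\<Omega> - N) + variation \<Omega> \<rho> N"
      using 1 by (simp add: add_left_mono)
    also have "\<dots> \<le> variation \<Omega> \<rho> ((\<Omega> - N) \<union> N)"
      by (intro variation_superadditive \<Omega> N) auto
    also have "(\<Omega> - N) \<union> N = \<Omega>"
      using N(1) by (auto simp: bs)
    finally show ?thesis .
  qed
  ultimately show ?thesis
    using norm_h by simp
qed

section \<open>Square integrable fields on a bounded set, and the minimisation\<close>

lemma bounded_measurable_in_L2:
  fixes w :: "'a::euclidean_space \<Rightarrow> 'b::euclidean_space"
  assumes "open \<Omega>" "bounded \<Omega>" "w \<in> borel_measurable (lebesgue_on \<Omega>)" "\<And>x. norm (w x) \<le> c"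
  shows "w \<in> L2 \<Omega>"
proof -
  have "\<Omega> \<in> lmeasurable"
    using assms(1,2) by (intro bounded_set_imp_lmeasurable) auto
  then interpret finite_measure "lebesgue_on \<Omega>"
    by (rule finite_measure_lebesgue_on)
  have "integrable (lebesgue_on \<Omega>) (\<lambda>x. (norm (w x))\<^sup>2)"
    using assms(3,4) by (intro integrable_const_bound[of _ "c\<^sup>2"]) (auto intro!: power_mono AE_I2)
  with assms(3) show ?thesis
    by (simp add: L2_def)
qed

text \<open>Expanding \<open>(norm (w x) - 1)\<^sup>2 \<ge> 0\<close> bounds the norm of
  \<open>w\<close> by \<open>1 + (norm (w x))\<^sup>2\<close>, which is integrable because \<Omega>
  has finite measure.\<close>

lemma L2_integrable:
  fixes w :: "'a::euclidean_space \<Rightarrow> 'b::euclidean_space"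
  assumes "open \<Omega>" "bounded \<Omega>" "w \<in> L2 \<Omega>"
  shows "integrable (lebesgue_on \<Omega>) w"
proof -
  have "\<Omega> \<in> lmeasurable"
    using assms(1,2) by (intro bounded_set_imp_lmeasurable) auto
  then interpret finite_measure "lebesgue_on \<Omega>"
    by (rule finite_measure_lebesgue_on)
  have "norm (w x) \<le> norm (1 + (norm (w x))\<^sup>2)" for x
  proof -
    have "2 * norm (w x) \<le> 1 + (norm (w x))\<^sup>2"
      using zero_le_power2[of "norm (w x) - 1"] by (simp add: power2_diff)
    then show ?thesis
      unfolding real_norm_def using norm_ge_zero[of "w x"] by linarith
  qed
  then show ?thesis
    using assms(3) unfolding L2_def
    by (intro Bochner_Integration.integrable_bound[of _ "\<lambda>x. 1 + (norm (w x))\<^sup>2" w]) auto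
qed

theorem proposition3p3:
  fixes \<Omega> :: "'a::euclidean_space set" and \<alpha> \<beta> :: real and u :: "'a \<Rightarrow> real"
  assumes "open \<Omega>" and "bounded \<Omega>" and "lipschitz_boundary \<Omega>"
    and "\<alpha> > 0" and "\<beta> > 0"
    and "u \<in> BV \<Omega>"
  shows "(\<exists>w \<in> L2 \<Omega>. (\<forall>v \<in> L2 \<Omega>. objective \<alpha> \<beta> \<Omega> u w \<le> objective \<alpha> \<beta> \<Omega> u v) \<and>
                      functional_F \<alpha> \<beta> \<Omega> u = objective \<alpha> \<beta> \<Omega> u w) \<and>
         functional_F \<alpha> \<beta> \<Omega> u =
           (LINT x|lebesgue_on \<Omega>. phi \<alpha> \<beta> (grad \<Omega> u x)) + \<alpha> * radon_norm \<Omega> (D_sing \<Omega> u)"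
proof -
  define g where "g = grad \<Omega> u"
  have "\<exists>\<mu>. distributional_derivative \<Omega> u \<mu>"
    using \<open>u \<in> BV \<Omega>\<close> by (simp add: BV_def)
  then have "distributional_derivative \<Omega> u (D \<Omega> u)"
    unfolding D_def by (rule someI_ex)
  then have "\<exists>g \<nu>. lebesgue_decomposition \<Omega> (D \<Omega> u) g \<nu>"
    using assms(1,2) by (intro lebesgue_decomposition_exists) (auto simp: distributional_derivative_def)
  \<comment> \<open>\<open>grad\<close> chooses a density alone; the existence of some decomposition
    makes that choice valid and supplies a singular part to go with it.\<close>
  then have "\<exists>\<nu>. lebesgue_decomposition \<Omega> (D \<Omega> u) g \<nu>"
    unfolding g_def grad_def by (rule someI_ex)
  then obtain \<nu> where g_int: "integrable (lebesgue_on \<Omega>) g"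
    and \<nu>: "finite_radon_measure \<Omega> \<nu>" "singular_measure \<Omega> \<nu>"
    and Du: "\<And>A. A \<in> borel_subsets \<Omega> \<Longrightarrow> D \<Omega> u A = lebesgue_density g A + \<nu> A"
    by (auto simp: lebesgue_decomposition_def)
  have \<nu>_fin: "variation \<Omega> \<nu> \<Omega> < \<infinity>"
    using \<nu>(1) by (simp add: finite_radon_measure_def)
  \<comment> \<open>\<open>D_sing\<close> and \<open>\<nu>\<close> are known to agree only on Borel
    subsets of \<Omega>, which is all that the variation sees.\<close>
  have sing: "radon_norm \<Omega> (D_sing \<Omega> u) = radon_norm \<Omega> \<nu>"
    unfolding radon_norm_def
    by (intro arg_cong[of _ _ enn2real] variation_cong) (simp add: D_sing_def Du g_def[symmetric])
  have sq: "(L2_norm \<Omega> v)\<^sup>2 = (LINT x|lebesgue_on \<Omega>. (norm (v x))\<^sup>2)" for v :: "'a \<Rightarrow> 'a"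
    unfolding L2_norm_def by (intro real_sqrt_pow2 Bochner_Integration.integral_nonneg) simp
  have int: "integrable (lebesgue_on \<Omega>) (\<lambda>x. \<alpha> * norm (g x - v x) + \<beta> / 2 * (norm (v x))\<^sup>2)"
    if "v \<in> L2 \<Omega>" for v
    using that g_int L2_integrable[OF assms(1,2) that] by (auto simp: L2_def)
  have obj: "objective \<alpha> \<beta> \<Omega> u v =
      (LINT x|lebesgue_on \<Omega>. \<alpha> * norm (g x - v x) + \<beta> / 2 * (norm (v x))\<^sup>2) + \<alpha> * radon_norm \<Omega> \<nu>"
    if v: "v \<in> L2 \<Omega>" for v
  proof -
    have v_int: "integrable (lebesgue_on \<Omega>) v"
      by (rule L2_integrable[OF assms(1,2) v])
    have "variation \<Omega> (\<lambda>A. D \<Omega> u A - lebesgue_density v A) \<Omega> =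
          ennreal (LINT x|lebesgue_on \<Omega>. norm (g x - v x)) + variation \<Omega> \<nu> \<Omega>"
    proof (rule variation_density_plus_singular[OF assms(1,2) _ \<nu>])
      fix A assume A: "A \<in> borel_subsets \<Omega>"
      then have "A \<in> sets lebesgue" "A \<subseteq> \<Omega>"
        using borel_subsets_open[OF \<open>open \<Omega>\<close>] by auto
      then have "lebesgue_density (\<lambda>x. g x - v x) A = lebesgue_density g A - lebesgue_density v A"
        unfolding lebesgue_density_def
        by (intro set_integral_diff set_integrable_lebesgue_on[OF \<open>open \<Omega>\<close>] g_int v_int)
      then show "D \<Omega> u A - lebesgue_density v A = lebesgue_density (\<lambda>x. g x - v x) A + \<nu> A"
        using Du[OF A] by simp
    qed (use g_int v_int in auto)
    \<comment> \<open>\<open>enn2real\<close> sends infinity to 0 and is additive only on finite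
      values, hence the appeal to \<open>\<nu>_fin\<close>.\<close>
    then have "radon_norm \<Omega> (\<lambda>A. D \<Omega> u A - lebesgue_density v A) =
        (LINT x|lebesgue_on \<Omega>. norm (g x - v x)) + radon_norm \<Omega> \<nu>"
      unfolding radon_norm_def using \<nu>_fin by (simp add: enn2real_plus less_top)
    then show ?thesis
      using v g_int v_int by (simp add: objective_def sq L2_def algebra_simps)
  qed
  define w where "w x = huber_min \<alpha> \<beta> (g x)" for x
  have "w \<in> borel_measurable (lebesgue_on \<Omega>)"
    unfolding w_def using borel_measurable_integrable[OF g_int] by measurable
  then have w: "w \<in> L2 \<Omega>"
    using norm_huber_min_le[OF \<open>\<alpha> > 0\<close> \<open>\<beta> > 0\<close>]
    by (intro bounded_measurable_in_L2[OF assms(1,2)]) (auto simp: w_def)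
  have phi_w: "phi \<alpha> \<beta> (g x) = \<alpha> * norm (g x - w x) + \<beta> / 2 * (norm (w x))\<^sup>2" for x
    unfolding w_def by (rule phi_eq_huber_min[OF \<open>\<alpha> > 0\<close> \<open>\<beta> > 0\<close>])
  have obj_w: "objective \<alpha> \<beta> \<Omega> u w = (LINT x|lebesgue_on \<Omega>. phi \<alpha> \<beta> (g x)) + \<alpha> * radon_norm \<Omega> \<nu>"
    unfolding phi_w by (rule obj[OF w])
  have min: "objective \<alpha> \<beta> \<Omega> u w \<le> objective \<alpha> \<beta> \<Omega> u v" if v: "v \<in> L2 \<Omega>" for v
    unfolding obj[OF v] obj[OF w]
  proof (intro add_right_mono integral_mono int v w)
    show "\<alpha> * norm (g x - w x) + \<beta> / 2 * (norm (w x))\<^sup>2 \<le> \<alpha> * norm (g x - v x) + \<beta> / 2 * (norm (v x))\<^sup>2" for x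
      unfolding phi_w[symmetric] by (rule phi_le[OF \<open>\<alpha> > 0\<close> \<open>\<beta> > 0\<close>])
  qed
  \<comment> \<open>\<open>LEAST\<close> over the reals denotes a minimum only if one is attained;
    \<open>w\<close> attains it.\<close>
  have F: "functional_F \<alpha> \<beta> \<Omega> u = objective \<alpha> \<beta> \<Omega> u w"
    unfolding functional_F_def by (rule Least_equality) (use w min in auto)
  have "functional_F \<alpha> \<beta> \<Omega> u =
      (LINT x|lebesgue_on \<Omega>. phi \<alpha> \<beta> (grad \<Omega> u x)) + \<alpha> * radon_norm \<Omega> (D_sing \<Omega> u)"
    unfolding F obj_w sing g_def ..
  then show ?thesis
    using w min F by blast
qed

end
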